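(* Let $b\ge 2$ and $s\ge 1$ be integers and let $\boldsymbol{e}=(e_1,\ldots,e_s)\in\mathbb{N}^s$. For each $r\in\mathbb{N}$ let $k_r\ge 0$ be the number of indices $i\in\{1,\ldots,s\}$ with $e_i=r$. If there exists a $(0,\boldsymbol{e},s)$-sequence in base $b$, then $k_r \le b^r$ for all $r \in \mathbb{N}$.
   Context: $\mathbb{N}$ denotes the set of positive integers and $\lambda_s$ the $s$-dimensional Lebesgue measure. Elementary interval: for integers $b\ge 2$, $s\ge 1$, an interval $J\subseteq[0,1)^s$ is an elementary interval in base $b$ if $J=\prod_{i=1}^s [a_ib^{-d_i},(a_i+1)b^{-d_i})$ with integers $d_i\ge 0$ and $0\le a_i<b^{d_i}$ for $1\le i\le s$. $(u,m,\boldsymbol{e},s)$-net: let $b\ge 2$, $s\ge 1$, $0\le u\le m$ be integers and $\boldsymbol{e}=(e_1,\ldots,e_s)\in\mathbb{N}^s$. A point set $\mathcal{P}$ of $b^m$ points in $[0,1)^s$ (an indexed family; points are counted with multiplicity) is a $(u,m,\boldsymbol{e},s)$-net in base $b$ if every elementary interval $J=\prod_{i=1}^s [a_ib^{-d_i},(a_i+1)b^{-d_i})$ in base $b$, with integers $d_i\ge 0$, $0\le a_i<b^{d_i}$ and $e_i\mid d_i$ for $1\le i\le s$ and with volume $\lambda_s(J)\ge b^{u-m}$, contains exactly $b^m\lambda_s(J)$ points of $\mathcal{P}$. Truncation: $[\boldsymbol{x}]_{b,m}$ denotes the coordinatewise $m$-digit truncation in base $b$ of $\boldsymbol{x}\in[0,1]^s$.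 That is, each coordinate $x$ of each point is given with a prescribed base-$b$ expansion $x=\sum_{j=1}^\infty y_jb^{-j}$, $y_j\in\{0,\ldots,b-1\}$ (the case where $y_j=b-1$ for all sufficiently large $j$ is allowed), and is replaced by $\sum_{j=1}^m y_jb^{-j}\in[0,1)$. $(u,\boldsymbol{e},s)$-sequence: let $b\ge 2$, $s\ge 1$, $u\ge 0$ be integers and $\boldsymbol{e}\in\mathbb{N}^s$. A sequence $\boldsymbol{x}_1,\boldsymbol{x}_2,\ldots$ of points in $[0,1]^s$ is a $(u,\boldsymbol{e},s)$-sequence in base $b$ if for all integers $g\ge 0$ and $m>u$, the points $[\boldsymbol{x}_n]_{b,m}$ with $gb^m<n\le (g+1)b^m$ form a $(u,m,\boldsymbol{e},s)$-net in base $b$. *)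

theory Defs
  imports "HOL-Analysis.Analysis"
begin

text \<open>
  The dimension s is the cardinality of a finite index type \<open>'s\<close>; points of
  \<open>[0,1]\<close> to the power s are vectors of type \<open>real ^ 's\<close>.
\<close>

definition elementary_interval ::
    "nat \<Rightarrow> ('s::finite \<Rightarrow> nat) \<Rightarrow> ('s \<Rightarrow> nat) \<Rightarrow> (real ^ 's) set" where
  "elementary_interval b d a =
     {x. \<forall>i. real (a i) / real b ^ d i \<le> x $ i \<and> x $ i < (real (a i) + 1) / real b ^ d i}"

text \<open>
  A point set is a family \<open>P\<close> indexed by a finite set \<open>I\<close>, so that points are counted
  with multiplicity.
\<close>

definition is_net ::
    "nat \<Rightarrow> nat \<Rightarrow> nat \<Rightarrow> ('s::finite \<Rightarrow> nat) \<Rightarrow> 'i set \<Rightarrow> ('i \<Rightarrow> real ^ 's) \<Rightarrow> bool" where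
  "is_net b u m e I P \<longleftrightarrow>
     b \<ge> 2 \<and> u \<le> m \<and> (\<forall>i. e i \<ge> 1) \<and>
     finite I \<and> card I = b ^ m \<and>
     (\<forall>n\<in>I. \<forall>i. 0 \<le> P n $ i \<and> P n $ i < 1) \<and>
     (\<forall>d a. (\<forall>i. a i < b ^ d i \<and> e i dvd d i) \<and>
        measure lborel (elementary_interval b d a) \<ge> real b powi (int u - int m) \<longrightarrow>
        real (card {n \<in> I. P n \<in> elementary_interval b d a}) =
          real b ^ m * measure lborel (elementary_interval b d a))"

text \<open>
  Digits are indexed from 1 (the value \<open>y 0\<close> is irrelevant). Expansions whose digits are
  eventually all equal to \<open>b - 1\<close> are allowed.
\<close>

definition is_expansion :: "nat \<Rightarrow> (nat \<Rightarrow> nat) \<Rightarrow> real \<Rightarrow> bool" where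
  "is_expansion b y x \<longleftrightarrow>
     (\<forall>j\<ge>1. y j < b) \<and> (\<lambda>j. real (y (Suc j)) / real b ^ Suc j) sums x"

definition truncation :: "nat \<Rightarrow> nat \<Rightarrow> ('s::finite \<Rightarrow> nat \<Rightarrow> nat) \<Rightarrow> real ^ 's" where
  "truncation b m y = (\<chi> i. \<Sum>j=1..m. real (y i j) / real b ^ j)"

text \<open>
  The sequence \<open>x 1, x 2, \<dots>\<close> comes with prescribed expansions: \<open>y n i\<close> is the digit
  sequence of the \<open>i\<close>-th coordinate of \<open>x n\<close>. The values \<open>x 0\<close> and \<open>y 0\<close> are irrelevant.
\<close>

definition is_sequence ::
    "nat \<Rightarrow> nat \<Rightarrow> ('s::finite \<Rightarrow> nat) \<Rightarrow> (nat \<Rightarrow> real ^ 's) \<Rightarrow>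
       (nat \<Rightarrow> 's \<Rightarrow> nat \<Rightarrow> nat) \<Rightarrow> bool" where
  "is_sequence b u e x y \<longleftrightarrow>
     b \<ge> 2 \<and> (\<forall>i. e i \<ge> 1) \<and>
     (\<forall>n\<ge>1. \<forall>i. 0 \<le> x n $ i \<and> x n $ i \<le> 1 \<and> is_expansion b (y n i) (x n $ i)) \<and>
     (\<forall>g m. m > u \<longrightarrow>
        is_net b u m e {g * b ^ m <.. (g + 1) * b ^ m} (\<lambda>n. truncation b m (y n)))"

end

theory Submission
  imports Defs
begin

text \<open>
  Put \<open>q = b ^ r\<close>, and call the integer formed by the first \<open>r\<close> digits of a coordinate its
  colour. In a sequence with \<open>u = 0\<close>, the net property with \<open>m = r\<close> says that inside any
  aligned block of \<open>q\<close> consecutive points, every colour occurs exactly once in each coordinate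
  \<open>i\<close> with \<open>e i = r\<close>. The net property with \<open>m = 2 * r\<close> says that among the first \<open>q\<^sup>2\<close>
  points, a point is determined by its colours in any two such coordinates
  (both are instances of \<open>sequence_unique_point\<close>).

  Now compare the first point with the second block of \<open>q\<close> points, which still lies among the
  first \<open>q\<^sup>2\<close> since \<open>q \<ge> 2\<close>. Each coordinate \<open>i\<close> with \<open>e i = r\<close> selects one point of that
  block, the one having the same colour as the first point in coordinate \<open>i\<close>. Two coordinates
  cannot select the same point, because that point would share two colours with the first point.
  So there are at most \<open>q\<close> such coordinates. This is a short form of the argument that an
  orthogonal array of strength 2 with \<open>q\<close> levels and \<open>q\<^sup>2\<close> runs has at most \<open>q + 1\<close> factors; the
  missing factor is the number of the block of length \<open>q\<close> in which a point lies.
\<close>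

section \<open>Volume of elementary intervals\<close>

text \<open>
  The half-open box lies between an open and a closed box with the same corners, and these have
  the same volume.
\<close>

lemma measure_elementary_interval:
  fixes d a :: "'s::finite \<Rightarrow> nat"
  assumes "b > 0"
  shows "measure lborel (elementary_interval b d a) = 1 / real b ^ (\<Sum>i\<in>UNIV. d i)"
proof -
  define l u :: "real ^ 's"
    where "l = (\<chi> i. real (a i) / real b ^ d i)"
      and "u = (\<chi> i. (real (a i) + 1) / real b ^ d i)"
  have le: "l $ i \<le> u $ i" for i
    using assms by (simp add: l_def u_def divide_right_mono)
  have ne: "cbox l u \<noteq> {}"
    using le by (simp add: interval_ne_empty_cart)
  have "measure lborel (cbox l u) = (\<Prod>i\<in>UNIV. u $ i - l $ i)"
    using content_cbox_cart[OF ne] .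
  also have "\<dots> = (\<Prod>i\<in>UNIV. 1 / real b ^ d i)"
    by (simp add: l_def u_def diff_divide_distrib[symmetric])
  also have "\<dots> = 1 / real b ^ (\<Sum>i\<in>UNIV. d i)"
    by (simp add: prod_dividef power_sum)
  finally have vol: "measure lborel (cbox l u) = 1 / real b ^ (\<Sum>i\<in>UNIV. d i)" .
  have eq: "elementary_interval b d a = {x. \<forall>i. l $ i \<le> x $ i \<and> x $ i < u $ i}"
    by (simp add: elementary_interval_def l_def u_def)
  have sub1: "box l u \<subseteq> elementary_interval b d a"
    and sub2: "elementary_interval b d a \<subseteq> cbox l u"
    by (auto simp: eq mem_box_cart less_imp_le)
  have "elementary_interval b d a = (\<Inter>i. {x. l $ i \<le> x $ i} \<inter> {x. x $ i < u $ i})"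
    by (auto simp: eq)
  moreover have "closed {x. l $ i \<le> x $ i}" "open {x. x $ i < u $ i}" for i
    by (auto intro!: closed_Collect_le open_Collect_less continuous_intros)
  ultimately have meas: "elementary_interval b d a \<in> sets lborel"
    by auto
  have "measure lborel (box l u) \<le> measure lborel (elementary_interval b d a)"
    using sub1 meas sub2
    by (intro measure_mono_fmeasurable)
       (auto intro: fmeasurableI2[OF fmeasurable_cbox])
  moreover have "measure lborel (elementary_interval b d a) \<le> measure lborel (cbox l u)"
    using sub2 meas by (intro measure_mono_fmeasurable) auto
  moreover have "measure lborel (box l u) = measure lborel (cbox l u)"
    by (simp add: measure_lborel_box_eq measure_lborel_cbox_eq)
  ultimately show ?thesis using vol by linarith
qed

lemma card_net_elementary_interval:
  fixes e d a :: "'s::finite \<Rightarrow> nat"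
  assumes net: "is_net b u m e I P"
    and a: "\<And>i. a i < b ^ d i" and d: "\<And>i. e i dvd d i"
    and vol: "(\<Sum>i\<in>UNIV. d i) + u \<le> m"
  shows "card {n \<in> I. P n \<in> elementary_interval b d a} = b ^ (m - (\<Sum>i\<in>UNIV. d i))"
proof -
  define D where "D = (\<Sum>i\<in>UNIV. d i)"
  have b: "b \<ge> 2" using net by (simp add: is_net_def)
  have M: "measure lborel (elementary_interval b d a) = 1 / real b ^ D"
    using measure_elementary_interval[of b d a] b by (simp add: D_def)
  have "D + u \<le> m" using vol by (simp add: D_def)
  hence "real b powi (int u - int m) \<le> real b powi (- int D)"
    using b by (intro power_int_increasing) auto
  hence "real b powi (int u - int m) \<le> measure lborel (elementary_interval b d a)"
    by (simp add: M power_int_minus divide_inverse)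
  moreover have "(\<forall>i. a i < b ^ d i \<and> e i dvd d i) \<and>
      measure lborel (elementary_interval b d a) \<ge> real b powi (int u - int m) \<longrightarrow>
      real (card {n \<in> I. P n \<in> elementary_interval b d a}) =
        real b ^ m * measure lborel (elementary_interval b d a)"
    using net unfolding is_net_def by blast
  ultimately have "real (card {n \<in> I. P n \<in> elementary_interval b d a}) =
      real b ^ m * (1 / real b ^ D)"
    using a d by (simp add: M)
  also have "\<dots> = real (b ^ (m - D))"
    using b vol by (simp add: power_diff[of "real b"] D_def)
  finally show ?thesis unfolding D_def by linarith
qed

section \<open>Digits and elementary intervals\<close>

definition digit_prefix :: "nat \<Rightarrow> nat \<Rightarrow> (nat \<Rightarrow> nat) \<Rightarrow> nat" where
  "digit_prefix b r y = (\<Sum>j=1..r. y j * b ^ (r - j))"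

lemma digit_prefix_0 [simp]: "digit_prefix b 0 y = 0"
  by (simp add: digit_prefix_def)

lemma digit_prefix_divide:
  assumes "b > 0"
  shows "real (digit_prefix b r y) / real b ^ r = (\<Sum>j=1..r. real (y j) / real b ^ j)"
proof -
  have "real (b ^ (r - j)) / real b ^ r = 1 / real b ^ j" if "j \<le> r" for j
    using assms that by (simp add: power_diff[of "real b"])
  hence "real (y j * b ^ (r - j)) / real b ^ r = real (y j) / real b ^ j" if "j \<le> r" for j
    unfolding of_nat_mult times_divide_eq_right[symmetric] using that by simp
  thus ?thesis
    unfolding digit_prefix_def of_nat_sum sum_divide_distrib by (intro sum.cong) auto
qed

text \<open>
  The term \<open>1 / b ^ m\<close> on the left makes the bound provable by induction; it also gives the strict
  inequality needed to stay inside a half-open interval.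
\<close>

lemma sum_digits_upper_bound:
  assumes "b > 0" and y: "\<And>j. j \<ge> 1 \<Longrightarrow> y j < b" and "r \<le> m"
  shows "(\<Sum>j=1..m. real (y j) / real b ^ j) + 1 / real b ^ m
           \<le> (\<Sum>j=1..r. real (y j) / real b ^ j) + 1 / real b ^ r"
  using \<open>r \<le> m\<close>
proof (induction m rule: dec_induct)
  case base
  show ?case by simp
next
  case (step m)
  have "real (y (Suc m)) + 1 \<le> real b"
    using y[of "Suc m"] by simp
  hence "(real (y (Suc m)) + 1) / real b ^ Suc m \<le> real b / real b ^ Suc m"
    by (intro divide_right_mono) auto
  also have "\<dots> = 1 / real b ^ m"
    using \<open>b > 0\<close> by simp
  finally show ?case
    using step.IH by (simp add: add_divide_distrib)
qed

lemma digit_prefix_less: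
  assumes "b > 0" and "\<And>j. j \<ge> 1 \<Longrightarrow> y j < b"
  shows "digit_prefix b r y < b ^ r"
proof -
  have "real (digit_prefix b r y) / real b ^ r + 1 / real b ^ r \<le> 1"
    using sum_digits_upper_bound[OF assms, where r = 0 and m = r] digit_prefix_divide[OF assms(1)] by simp
  hence "(real (digit_prefix b r y) + 1) / real b ^ r \<le> 1"
    by (simp add: add_divide_distrib)
  hence "real (digit_prefix b r y) + 1 \<le> real b ^ r"
    using assms(1) by (simp add: divide_le_eq_1)
  hence "real (digit_prefix b r y) + 1 \<le> real (b ^ r)"
    by simp
  thus ?thesis
    by linarith
qed

text \<open>
  In coordinate \<open>i\<close>, the digits kept after the first \<open>d i\<close> contribute less than \<open>1 / b ^ d i\<close>,
  so membership does not depend on the truncation length \<open>m\<close> once it is at least every \<open>d i\<close>.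
  This is what allows nets with different \<open>m\<close> to be compared.
\<close>

lemma truncation_in_elementary_interval_iff:
  fixes y :: "'s::finite \<Rightarrow> nat \<Rightarrow> nat"
  assumes b: "b > 0" and y: "\<And>i j. j \<ge> 1 \<Longrightarrow> y i j < b" and d: "\<And>i. d i \<le> m"
  shows "truncation b m y \<in> elementary_interval b d a \<longleftrightarrow> (\<forall>i. digit_prefix b (d i) (y i) = a i)"
proof -
  have "real (a i) / real b ^ d i \<le> truncation b m y $ i \<and>
        truncation b m y $ i < (real (a i) + 1) / real b ^ d i \<longleftrightarrow>
        digit_prefix b (d i) (y i) = a i" (is "?L \<longleftrightarrow> ?p = a i") for i
  proof -
    define t where "t = truncation b m y $ i"
    have t: "t = (\<Sum>j=1..m. real (y i j) / real b ^ j)"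
      by (simp add: t_def truncation_def)
    have pos: "real b ^ d i > 0" "1 / real b ^ m > 0"
      using b by simp_all
    have "real ?p / real b ^ d i \<le> t"
      unfolding t digit_prefix_divide[OF b] using d[of i] by (intro sum_mono2) auto
    hence lo: "real ?p \<le> t * real b ^ d i"
      using pos by (simp add: field_simps)
    have "t + 1 / real b ^ m \<le> real ?p / real b ^ d i + 1 / real b ^ d i"
      unfolding t digit_prefix_divide[OF b] by (rule sum_digits_upper_bound[OF b y d])
    hence "t < (real ?p + 1) / real b ^ d i"
      unfolding add_divide_distrib using pos(2) by linarith
    hence hi: "t * real b ^ d i < real ?p + 1"
      using pos by (simp add: pos_less_divide_eq)
    have "?L \<longleftrightarrow> real (a i) \<le> t * real b ^ d i \<and> t * real b ^ d i < real (a i) + 1"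
      using pos by (simp add: t_def pos_less_divide_eq pos_divide_le_eq)
    also have "\<dots> \<longleftrightarrow> ?p = a i"
      using lo hi by linarith
    finally show ?thesis .
  qed
  thus ?thesis by (simp add: elementary_interval_def)
qed

section \<open>Sequences of quality parameter zero\<close>

lemma sequence_digit_less:
  assumes "is_sequence b u e x y" "n \<ge> 1" "j \<ge> 1"
  shows "y n i j < b"
  using assms by (auto simp: is_sequence_def is_expansion_def)

text \<open>
  The interval prescribing the digits has volume \<open>1 / b ^ m\<close>, the smallest that the net property
  with \<open>u = 0\<close> controls, so it holds exactly one of the \<open>b ^ m\<close> points. Coordinates with
  \<open>d i = 0\<close> are unconstrained: both sides of the equation are then 0.
\<close>

lemma sequence_unique_point:
  fixes e d a :: "'s::finite \<Rightarrow> nat"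
  assumes seq: "is_sequence b 0 e x y"
    and a: "\<And>i. a i < b ^ d i" and d: "\<And>i. e i dvd d i"
    and m: "(\<Sum>i\<in>UNIV. d i) = m" "m > 0"
  shows "\<exists>!n. n \<in> {g * b ^ m <.. (g + 1) * b ^ m} \<and> (\<forall>i. digit_prefix b (d i) (y n i) = a i)"
proof -
  let ?I = "{g * b ^ m <.. (g + 1) * b ^ m}"
  have b: "b > 0" using seq by (simp add: is_sequence_def)
  have net: "is_net b 0 m e ?I (\<lambda>n. truncation b m (y n))"
    using seq m(2) by (simp add: is_sequence_def)
  have dm: "d i \<le> m" for i
    using m(1) member_le_sum[of i UNIV d] by simp
  have "truncation b m (y n) \<in> elementary_interval b d a \<longleftrightarrow>
          (\<forall>i. digit_prefix b (d i) (y n i) = a i)" if "n \<in> ?I" for n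
    using that by (intro truncation_in_elementary_interval_iff b dm sequence_digit_less[OF seq]) auto
  hence "{n \<in> ?I. \<forall>i. digit_prefix b (d i) (y n i) = a i} =
         {n \<in> ?I. truncation b m (y n) \<in> elementary_interval b d a}"
    by blast
  hence "card {n \<in> ?I. \<forall>i. digit_prefix b (d i) (y n i) = a i} = 1"
    using card_net_elementary_interval[OF net a d] m(1) by simp
  then obtain n where "{n \<in> ?I. \<forall>i. digit_prefix b (d i) (y n i) = a i} = {n}"
    by (auto simp: card_1_singleton_iff)
  thus ?thesis
    by (intro ex1I[of _ n]) blast+
qed

theorem theorem4:
  fixes b :: nat and e :: "'s::finite \<Rightarrow> nat"
  assumes "b \<ge> 2"
    and "\<forall>i. e i \<ge> 1"
    and "\<exists>x y. is_sequence b 0 e x y"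
  shows "\<forall>r\<ge>1. card {i. e i = r} \<le> b ^ r"
proof (intro allI impI)
  fix r :: nat assume r: "r \<ge> 1"
  obtain x y where seq: "is_sequence b 0 e x y"
    using assms(3) by blast
  let ?c = "\<lambda>n i. digit_prefix b r (y n i)"
  let ?B = "{1 * b ^ r <.. (1 + 1) * b ^ r}"
  have b: "b > 0" and q: "b ^ r \<ge> 2"
    using assms(1) r self_le_power[of b r] by linarith+
  have less: "digit_prefix b k (y 1 i) < b ^ k" for k i
    using digit_prefix_less[OF b] sequence_digit_less[OF seq] by simp

  have "\<exists>n\<in>?B. ?c n i = ?c 1 i" if i: "e i = r" for i
  proof -
    define d where "d = (\<lambda>k. if k = i then r else 0)"
    have "\<exists>!n. n \<in> ?B \<and>
            (\<forall>k. digit_prefix b (d k) (y n k) = digit_prefix b (d k) (y 1 k))"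
      by (rule sequence_unique_point[OF seq less]) (use i r in \<open>auto simp: d_def\<close>)
    then obtain n where "n \<in> ?B" "digit_prefix b (d i) (y n i) = digit_prefix b (d i) (y 1 i)"
      by blast
    thus ?thesis by (auto simp: d_def)
  qed
  then obtain f where f: "\<And>i. e i = r \<Longrightarrow> f i \<in> ?B \<and> ?c (f i) i = ?c 1 i"
    by metis

  have "inj_on f {i. e i = r}"
  proof (rule inj_onI, rule ccontr)
    fix i j assume ij: "i \<in> {i. e i = r}" "j \<in> {i. e i = r}" "f i = f j" "i \<noteq> j"
    define d where "d = (\<lambda>k. if k = i \<or> k = j then r else 0)"
    let ?I = "{0 * b ^ (2 * r) <.. (0 + 1) * b ^ (2 * r)}"
    have "(\<Sum>k\<in>UNIV. d k) = (\<Sum>k\<in>{i, j}. r)"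
      unfolding d_def by (intro sum.mono_neutral_cong_right) auto
    hence sum: "(\<Sum>k\<in>UNIV. d k) = 2 * r"
      using ij(4) by simp
    have uniq: "\<exists>!n. n \<in> ?I \<and>
            (\<forall>k. digit_prefix b (d k) (y n k) = digit_prefix b (d k) (y 1 k))"
      by (rule sequence_unique_point[OF seq less _ sum]) (use ij r in \<open>auto simp: d_def\<close>)
    have "2 * b ^ r \<le> b ^ r * b ^ r"
      using q by (rule mult_right_mono) simp
    also have "\<dots> = b ^ (2 * r)"
      by (simp add: mult_2 power_add)
    finally have "2 * b ^ r \<le> b ^ (2 * r)" .
    moreover have fi: "f i \<in> ?B" "?c (f i) i = ?c 1 i" "?c (f i) j = ?c 1 j"
      using f[of i] f[of j] ij by auto
    ultimately have "f i \<in> ?I" "1 \<in> ?I"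
      using b by auto
    moreover have "\<forall>k. digit_prefix b (d k) (y (f i) k) = digit_prefix b (d k) (y 1 k)"
      using fi by (simp add: d_def)
    ultimately have "f i = 1"
      using uniq by blast
    thus False
      using fi(1) q b by auto
  qed
  moreover have "f ` {i. e i = r} \<subseteq> ?B"
    using f by blast
  ultimately have "card {i. e i = r} \<le> card ?B"
    by (intro card_inj_on_le) auto
  thus "card {i. e i = r} \<le> b ^ r"
    by simp
qed

end
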